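(* If $I$ is a finite acyclic category and $\mathcal{C}$ is a finite, acyclic, monic, and left locally totally ordered category, then the functor category $[I,\mathcal{C}]$ is finite, acyclic, monic, and left locally totally ordered. Hence $[I,\mathcal{C}]$ is weakly word-embeddable.
   Context: $[I,\mathcal{C}]$ is the category of functors $I\to\mathcal{C}$ and natural transformations. A finite category has finitely many objects and morphisms. A small category $\mathcal{C}$ is acyclic if for all distinct objects $c\neq d$, $\mathrm{Hom}(c,d)\neq\varnothing$ implies $\mathrm{Hom}(d,c)=\varnothing$, and $\mathrm{Hom}(c,c)=\{\mathrm{id}_c\}$ for every object $c$. A category is monic if every morphism is a monomorphism. A small category is left locally totally ordered if each hom-set $\mathrm{Hom}(c,d)$ can be equipped with a total order such that, for all objects $c,d,e$, every $g\colon d\to e$ and all $f_1,f_2\in\mathrm{Hom}(c,d)$, $f_1<f_2$ implies $g\circ f_1<g\circ f_2$. A word of length $n$ over an alphabet (set) $\Sigma$ is a function $w\colon[n]\to\Sigma$, where $[n]=\{1,\dots,n\}$. For words $w\colon[n]\to\Sigma$ and $w'\colon[m]\to\Sigma$, a subword inclusion $w'\to w$ is an injective order-preserving map $f\colon[m]\to[n]$ with $w\circ f=w'$. $\mathrm{Word}(\Sigma)$ is the category of words over $\Sigma$ and subword inclusions, and $\mathrm{Sub}_w$ is its full subcategory spanned by all words that admit a morphism into $w$. A category $\mathcal{D}$ is weakly word-embeddable if there exist an alphabet $\Sigma$, a word $w$ over $\Sigma$, and a functor $\mathcal{D}\to\mathrm{Sub}_w$ that is faithful and injective on objects. *)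

theory Defs
  imports Main "HOL-Library.FuncSet"
begin

section \<open>Small categories\<close>

text \<open>
  A category is given by a set of objects and a set of arrows; \<open>Comp C g f\<close> is
  \<open>g \<circ> f\<close> (first \<open>f\<close>, then \<open>g\<close>) and is only meaningful if \<open>Cod C f = Dom C g\<close>.
\<close>

record ('o, 'm) precategory =
  Obj :: "'o set"
  Arr :: "'m set"
  Dom :: "'m \<Rightarrow> 'o"
  Cod :: "'m \<Rightarrow> 'o"
  Ident :: "'o \<Rightarrow> 'm"
  Comp :: "'m \<Rightarrow> 'm \<Rightarrow> 'm"

definition hom :: "('o, 'm) precategory \<Rightarrow> 'o \<Rightarrow> 'o \<Rightarrow> 'm set" where
  "hom C c d = {f \<in> Arr C. Dom C f = c \<and> Cod C f = d}"

locale category =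
  fixes C :: "('o, 'm) precategory"
  assumes Dom_in_Obj: "f \<in> Arr C \<Longrightarrow> Dom C f \<in> Obj C"
    and Cod_in_Obj: "f \<in> Arr C \<Longrightarrow> Cod C f \<in> Obj C"
    and Ident_in_hom: "c \<in> Obj C \<Longrightarrow> Ident C c \<in> hom C c c"
    and Comp_in_hom: "f \<in> hom C b c \<Longrightarrow> g \<in> hom C c d \<Longrightarrow> Comp C g f \<in> hom C b d"
    and Comp_Ident_left: "f \<in> hom C c d \<Longrightarrow> Comp C (Ident C d) f = f"
    and Comp_Ident_right: "f \<in> hom C c d \<Longrightarrow> Comp C f (Ident C c) = f"
    and Comp_assoc: "f \<in> hom C a b \<Longrightarrow> g \<in> hom C b c \<Longrightarrow> h \<in> hom C c d \<Longrightarrow>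
      Comp C h (Comp C g f) = Comp C (Comp C h g) f"

locale finite_category = category +
  assumes finite_Obj: "finite (Obj C)"
    and finite_Arr: "finite (Arr C)"

locale acyclic_category = category +
  assumes hom_antisym:
      "c \<in> Obj C \<Longrightarrow> d \<in> Obj C \<Longrightarrow> c \<noteq> d \<Longrightarrow> hom C c d \<noteq> {} \<Longrightarrow> hom C d c = {}"
    and hom_self: "c \<in> Obj C \<Longrightarrow> hom C c c = {Ident C c}"

definition monomorphism :: "('o, 'm) precategory \<Rightarrow> 'm \<Rightarrow> bool" where
  "monomorphism C f \<longleftrightarrow> f \<in> Arr C \<and>
    (\<forall>b\<in>Obj C. \<forall>g\<in>hom C b (Dom C f). \<forall>h\<in>hom C b (Dom C f).
       Comp C f g = Comp C f h \<longrightarrow> g = h)"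

locale monic_category = category +
  assumes all_mono: "f \<in> Arr C \<Longrightarrow> monomorphism C f"

text \<open>
  \<open>R c d\<close> is the (reflexive) total order on \<open>hom C c d\<close>; hence \<open>f\<^sub>1 < f\<^sub>2\<close> reads
  \<open>(f\<^sub>1, f\<^sub>2) \<in> R c d \<and> f\<^sub>1 \<noteq> f\<^sub>2\<close>.
\<close>

locale left_locally_totally_ordered_category = category +
  assumes ex_left_compatible_orders:
    "\<exists>R. (\<forall>c\<in>Obj C. \<forall>d\<in>Obj C. linear_order_on (hom C c d) (R c d)) \<and>
      (\<forall>c\<in>Obj C. \<forall>d\<in>Obj C. \<forall>e\<in>Obj C. \<forall>g\<in>hom C d e. \<forall>f\<^sub>1\<in>hom C c d. \<forall>f\<^sub>2\<in>hom C c d.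
         (f\<^sub>1, f\<^sub>2) \<in> R c d \<and> f\<^sub>1 \<noteq> f\<^sub>2 \<longrightarrow>
         (Comp C g f\<^sub>1, Comp C g f\<^sub>2) \<in> R c e \<and> Comp C g f\<^sub>1 \<noteq> Comp C g f\<^sub>2)"

definition full_subcategory :: "('o, 'm) precategory \<Rightarrow> 'o set \<Rightarrow> ('o, 'm) precategory" where
  "full_subcategory C S =
    C\<lparr>Obj := Obj C \<inter> S, Arr := {f \<in> Arr C. Dom C f \<in> S \<and> Cod C f \<in> S}\<rparr>"


section \<open>Functors, natural transformations and functor categories\<close>

text \<open>
  The maps underlying a functor, and the family of components of a natural transformation,
  are required to be extensional: HOL functions are total, and without this condition one
  functor would be represented by many elements, so that the objects and arrows of a functor
  category would be counted wrongly.
\<close>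

record ('o, 'm, 'p, 'n) functor_data =
  FObj :: "'o \<Rightarrow> 'p"
  FArr :: "'m \<Rightarrow> 'n"

locale is_functor = src: category C + tgt: category D
  for C :: "('o, 'm) precategory" and D :: "('p, 'n) precategory" +
  fixes F :: "('o, 'm, 'p, 'n) functor_data"
  assumes FObj_funcset: "FObj F \<in> Obj C \<rightarrow>\<^sub>E Obj D"
    and FArr_funcset: "FArr F \<in> Arr C \<rightarrow>\<^sub>E Arr D"
    and FArr_hom: "f \<in> hom C c d \<Longrightarrow> FArr F f \<in> hom D (FObj F c) (FObj F d)"
    and FArr_Ident: "c \<in> Obj C \<Longrightarrow> FArr F (Ident C c) = Ident D (FObj F c)"
    and FArr_Comp: "f \<in> hom C a b \<Longrightarrow> g \<in> hom C b c \<Longrightarrow>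
      FArr F (Comp C g f) = Comp D (FArr F g) (FArr F f)"

definition faithful ::
  "('o, 'm) precategory \<Rightarrow> ('o, 'm, 'p, 'n) functor_data \<Rightarrow> bool" where
  "faithful C F \<longleftrightarrow> (\<forall>c\<in>Obj C. \<forall>d\<in>Obj C. inj_on (FArr F) (hom C c d))"

definition injective_on_objects ::
  "('o, 'm) precategory \<Rightarrow> ('o, 'm, 'p, 'n) functor_data \<Rightarrow> bool" where
  "injective_on_objects C F \<longleftrightarrow> inj_on (FObj F) (Obj C)"

record ('o, 'm, 'p, 'n) nat_trans_data =
  NSrc :: "('o, 'm, 'p, 'n) functor_data"
  NTgt :: "('o, 'm, 'p, 'n) functor_data"
  NComp :: "'o \<Rightarrow> 'n"

locale is_nat_trans = src: is_functor C D "NSrc t" + tgt: is_functor C D "NTgt t"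
  for C :: "('o, 'm) precategory" and D :: "('p, 'n) precategory"
    and t :: "('o, 'm, 'p, 'n) nat_trans_data" +
  assumes NComp_extensional: "NComp t \<in> extensional (Obj C)"
    and NComp_hom: "c \<in> Obj C \<Longrightarrow> NComp t c \<in> hom D (FObj (NSrc t) c) (FObj (NTgt t) c)"
    and naturality: "f \<in> hom C c d \<Longrightarrow>
      Comp D (NComp t d) (FArr (NSrc t) f) = Comp D (FArr (NTgt t) f) (NComp t c)"

definition functor_category :: "('o, 'm) precategory \<Rightarrow> ('p, 'n) precategory \<Rightarrow>
    (('o, 'm, 'p, 'n) functor_data, ('o, 'm, 'p, 'n) nat_trans_data) precategory" where
  "functor_category I C =
    \<lparr>Obj = {F. is_functor I C F},
     Arr = {t. is_nat_trans I C t},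
     Dom = NSrc,
     Cod = NTgt,
     Ident = (\<lambda>F. \<lparr>NSrc = F, NTgt = F, NComp = (\<lambda>i\<in>Obj I. Ident C (FObj F i))\<rparr>),
     Comp = (\<lambda>s t. \<lparr>NSrc = NSrc t, NTgt = NTgt s,
                     NComp = (\<lambda>i\<in>Obj I. Comp C (NComp s i) (NComp t i))\<rparr>)\<rparr>"


section \<open>Words and subword inclusions\<close>

text \<open>
  A word of length \<open>n\<close> is a list of length \<open>n\<close>, so positions are \<open>{..<n}\<close> instead of
  \<open>{1..n}\<close>. An arrow \<open>(w', w, f)\<close> carries its source and target along with the
  (extensional) map \<open>f\<close> on positions.
\<close>

definition subword_inclusion :: "'s list \<Rightarrow> 's list \<Rightarrow> (nat \<Rightarrow> nat) \<Rightarrow> bool" where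
  "subword_inclusion w' w f \<longleftrightarrow>
    f \<in> {..<length w'} \<rightarrow>\<^sub>E {..<length w} \<and> inj_on f {..<length w'} \<and>
    mono_on {..<length w'} f \<and> (\<forall>i<length w'. w ! f i = w' ! i)"

type_synonym 's word_arrow = "'s list \<times> 's list \<times> (nat \<Rightarrow> nat)"

definition Word :: "'s set \<Rightarrow> ('s list, 's word_arrow) precategory" where
  "Word \<Sigma> =
    \<lparr>Obj = lists \<Sigma>,
     Arr = {(w', w, f). w' \<in> lists \<Sigma> \<and> w \<in> lists \<Sigma> \<and> subword_inclusion w' w f},
     Dom = (\<lambda>(w', w, f). w'),
     Cod = (\<lambda>(w', w, f). w),
     Ident = (\<lambda>w. (w, w, \<lambda>i\<in>{..<length w}. i)),
     Comp = (\<lambda>(v', v, g) (w', w, f). (w', v, \<lambda>i\<in>{..<length w'}. g (f i)))\<rparr>"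

definition Sub :: "'s set \<Rightarrow> 's list \<Rightarrow> ('s list, 's word_arrow) precategory" where
  "Sub \<Sigma> w = full_subcategory (Word \<Sigma>) {w' \<in> Obj (Word \<Sigma>). hom (Word \<Sigma>) w' w \<noteq> {}}"

definition weak_word_embedding ::
  "('o, 'm) precategory \<Rightarrow> 's set \<Rightarrow> 's list \<Rightarrow>
    ('o, 'm, 's list, 's word_arrow) functor_data \<Rightarrow> bool" where
  "weak_word_embedding D \<Sigma> w F \<longleftrightarrow>
    w \<in> Obj (Word \<Sigma>) \<and> is_functor D (Sub \<Sigma> w) F \<and> faithful D F \<and> injective_on_objects D F"

text \<open>
  HOL cannot quantify existentially over the type of letters, so alphabets are taken to be
  sets of natural numbers. Only the finitely many letters of \<open>w\<close> matter, hence this is no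
  restriction: see \<open>weakly_word_embeddable_any_alphabet\<close> below.
\<close>

definition weakly_word_embeddable :: "('o, 'm) precategory \<Rightarrow> bool" where
  "weakly_word_embeddable D \<longleftrightarrow>
    (\<exists>(\<Sigma> :: nat set) w F. weak_word_embedding D \<Sigma> w F)"


section \<open>Well-formedness of the constructions\<close>

lemma homI: "f \<in> Arr C \<Longrightarrow> Dom C f = c \<Longrightarrow> Cod C f = d \<Longrightarrow> f \<in> hom C c d"
  by (simp add: hom_def)

lemma category_full_subcategory:
  assumes "category C"
  shows "category (full_subcategory C S)"
proof -
  interpret category C by fact
  have hom_iff: "f \<in> hom (full_subcategory C S) c d \<longleftrightarrow> f \<in> hom C c d \<and> c \<in> S \<and> d \<in> S"
    for f c d by (auto simp: hom_def full_subcategory_def)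
  show ?thesis
  proof (unfold_locales, goal_cases)
    case (1 f) then show ?case using Dom_in_Obj by (auto simp: full_subcategory_def)
  next
    case (2 f) then show ?case using Cod_in_Obj by (auto simp: full_subcategory_def)
  next
    case (3 c) then show ?case using Ident_in_hom[of c]
      by (auto simp: hom_iff) (auto simp: full_subcategory_def)
  next
    case (4 f b c g d) then show ?case using Comp_in_hom[of f b c g d]
      by (auto simp: hom_iff) (auto simp: full_subcategory_def)
  next
    case (5 f c d) then show ?case using Comp_Ident_left[of f c d]
      by (auto simp: hom_iff) (auto simp: full_subcategory_def)
  next
    case (6 f c d) then show ?case using Comp_Ident_right[of f c d]
      by (auto simp: hom_iff) (auto simp: full_subcategory_def)
  next
    case (7 f a b g c h d) then show ?case using Comp_assoc[of f a b g c h d]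
      by (auto simp: hom_iff) (auto simp: full_subcategory_def)
  qed
qed

lemma hom_Word:
  "x \<in> hom (Word \<Sigma>) u v \<longleftrightarrow>
    (\<exists>f. x = (u, v, f) \<and> u \<in> lists \<Sigma> \<and> v \<in> lists \<Sigma> \<and> subword_inclusion u v f)"
  by (auto simp: hom_def Word_def)

lemma subword_inclusion_id: "subword_inclusion w w (\<lambda>i\<in>{..<length w}. i)"
  by (auto simp: subword_inclusion_def inj_on_def monotone_on_def)

lemma subword_inclusion_comp:
  assumes "subword_inclusion u v f" "subword_inclusion v w g"
  shows "subword_inclusion u w (\<lambda>i\<in>{..<length u}. g (f i))"
proof -
  have f: "f i < length v" if "i < length u" for i
    using assms(1) that by (auto simp: subword_inclusion_def PiE_iff)
  show ?thesis
    using assms f unfolding subword_inclusion_def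
    by (auto simp: PiE_iff inj_on_def monotone_on_def)
qed

lemma category_Word: "category (Word \<Sigma>)"
proof (unfold_locales, goal_cases)
  case (1 f) then show ?case by (auto simp: Word_def)
next
  case (2 f) then show ?case by (auto simp: Word_def)
next
  case (3 c) then show ?case
    unfolding hom_Word using subword_inclusion_id[of c] by (auto simp: Word_def)
next
  case (4 f b c g d) then show ?case
    unfolding hom_Word using subword_inclusion_comp by (auto simp: Word_def)
next
  case (5 f c d) then show ?case
    unfolding hom_Word
    by (auto simp: Word_def subword_inclusion_def PiE_iff extensional_def fun_eq_iff)
next
  case (6 f c d) then show ?case
    unfolding hom_Word
    by (auto simp: Word_def subword_inclusion_def PiE_iff extensional_def fun_eq_iff)
next
  case (7 f a b g c h d) then show ?case
    unfolding hom_Word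
    by (auto simp: Word_def subword_inclusion_def PiE_iff fun_eq_iff)
qed

lemma category_Sub: "category (Sub \<Sigma> w)"
  unfolding Sub_def by (rule category_full_subcategory[OF category_Word])

lemma hom_functor_category:
  "t \<in> hom (functor_category I C) F G \<longleftrightarrow> is_nat_trans I C t \<and> NSrc t = F \<and> NTgt t = G"
  by (simp add: hom_def functor_category_def)

lemma nat_trans_data_eqI:
  fixes s t :: "('o, 'm, 'p, 'n) nat_trans_data"
  assumes "NSrc s = NSrc t" "NTgt s = NTgt t"
    and "NComp s \<in> extensional A" "NComp t \<in> extensional A"
    and "\<And>i. i \<in> A \<Longrightarrow> NComp s i = NComp t i"
  shows "s = t"
  using assms by (auto intro!: nat_trans_data.equality extensionalityI)

lemma is_nat_trans_Ident:
  assumes "is_functor I C F"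
  shows "is_nat_trans I C (Ident (functor_category I C) F)"
proof -
  interpret is_functor I C F by fact
  have O: "FObj F i \<in> Obj C" if "i \<in> Obj I" for i using FObj_funcset that by auto
  show ?thesis
  proof (intro is_nat_trans.intro is_nat_trans_axioms.intro, goal_cases)
    case 1 show ?case using assms by (simp add: functor_category_def)
  next
    case 2 show ?case using assms by (simp add: functor_category_def)
  next
    case 3 show ?case by (simp add: functor_category_def)
  next
    case (4 c) then show ?case using O tgt.Ident_in_hom by (simp add: functor_category_def)
  next
    case (5 f c d)
    then have "c \<in> Obj I" "d \<in> Obj I"
      using src.Dom_in_Obj src.Cod_in_Obj by (auto simp: hom_def)
    then show ?case
      using FArr_hom[OF 5] tgt.Comp_Ident_left tgt.Comp_Ident_right
      by (simp add: functor_category_def)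
  qed
qed

lemma is_nat_trans_Comp:
  assumes "is_nat_trans I C t" "is_nat_trans I C s" "NTgt t = NSrc s"
  shows "is_nat_trans I C (Comp (functor_category I C) s t)"
proof -
  interpret t: is_nat_trans I C t by fact
  interpret s: is_nat_trans I C s by fact
  have th: "NComp t i \<in> hom C (FObj (NSrc t) i) (FObj (NSrc s) i)" if "i \<in> Obj I" for i
    using t.NComp_hom[OF that] assms(3) by simp
  show ?thesis
  proof (intro is_nat_trans.intro is_nat_trans_axioms.intro, goal_cases)
    case 1 show ?case using t.src.is_functor_axioms by (simp add: functor_category_def)
  next
    case 2 show ?case using s.tgt.is_functor_axioms by (simp add: functor_category_def)
  next
    case 3 show ?case by (simp add: functor_category_def)
  next
    case (4 c) then show ?case
      using t.src.tgt.Comp_in_hom[OF th s.NComp_hom] by (simp add: functor_category_def)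
  next
    case (5 f c d)
    then have cd: "c \<in> Obj I" "d \<in> Obj I"
      using t.src.src.Dom_in_Obj t.src.src.Cod_in_Obj by (auto simp: hom_def)
    note A = t.src.tgt.Comp_assoc
    have "Comp C (Comp C (NComp s d) (NComp t d)) (FArr (NSrc t) f)
        = Comp C (NComp s d) (Comp C (NComp t d) (FArr (NSrc t) f))"
      using A[OF t.src.FArr_hom[OF 5] th s.NComp_hom] cd by simp
    also have "\<dots> = Comp C (NComp s d) (Comp C (FArr (NSrc s) f) (NComp t c))"
      using t.naturality[OF 5] assms(3) by simp
    also have "\<dots> = Comp C (Comp C (NComp s d) (FArr (NSrc s) f)) (NComp t c)"
      using A[OF th s.src.FArr_hom[OF 5] s.NComp_hom] cd by simp
    also have "\<dots> = Comp C (Comp C (FArr (NTgt s) f) (NComp s c)) (NComp t c)"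
      using s.naturality[OF 5] by simp
    also have "\<dots> = Comp C (FArr (NTgt s) f) (Comp C (NComp s c) (NComp t c))"
      using A[OF th s.NComp_hom s.tgt.FArr_hom[OF 5]] cd by simp
    finally show ?case using cd by (simp add: functor_category_def)
  qed
qed

lemma category_functor_category:
  fixes I :: "('o, 'm) precategory" and C :: "('p, 'n) precategory"
  assumes "category I" "category C"
  shows "category (functor_category I C)"
proof -
  interpret C: category C by fact
  have ext: "NComp t \<in> extensional (Obj I)"
    and hm: "i \<in> Obj I \<Longrightarrow> NComp t i \<in> hom C (FObj (NSrc t) i) (FObj (NTgt t) i)"
    if "is_nat_trans I C t" for t :: "('o, 'm, 'p, 'n) nat_trans_data" and i
    using that by (auto dest: is_nat_trans.NComp_extensional is_nat_trans.NComp_hom)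
  show ?thesis
  proof (unfold_locales, goal_cases)
    case (1 f) then show ?case by (auto simp: functor_category_def is_nat_trans_def)
  next
    case (2 f) then show ?case by (auto simp: functor_category_def is_nat_trans_def)
  next
    case (3 F) then show ?case unfolding hom_functor_category
      using is_nat_trans_Ident[of I C F] by (auto simp: functor_category_def)
  next
    case (4 f b c g d) then show ?case unfolding hom_functor_category
      using is_nat_trans_Comp[of I C f g] by (auto simp: functor_category_def)
  next
    case (5 f F G)
    then have f: "is_nat_trans I C f" "NSrc f = F" "NTgt f = G"
      by (auto simp: hom_functor_category)
    show ?case
      by (rule nat_trans_data_eqI[where A = "Obj I"])
         (use f ext[OF f(1)] C.Comp_Ident_left[OF hm[OF f(1)]] in
           \<open>auto simp: functor_category_def\<close>)
  next
    case (6 f F G)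
    then have f: "is_nat_trans I C f" "NSrc f = F" "NTgt f = G"
      by (auto simp: hom_functor_category)
    show ?case
      by (rule nat_trans_data_eqI[where A = "Obj I"])
         (use f ext[OF f(1)] C.Comp_Ident_right[OF hm[OF f(1)]] in
           \<open>auto simp: functor_category_def\<close>)
  next
    case (7 f F G g H h K)
    then have *: "is_nat_trans I C f" "NTgt f = G" "is_nat_trans I C g" "NSrc g = G"
      "NTgt g = H" "is_nat_trans I C h" "NSrc h = H"
      by (auto simp: hom_functor_category)
    have "Comp C (NComp h i) (Comp C (NComp g i) (NComp f i)) =
          Comp C (Comp C (NComp h i) (NComp g i)) (NComp f i)" if i: "i \<in> Obj I" for i
      using C.Comp_assoc hm[OF *(1) i] hm[OF *(3) i] hm[OF *(6) i] * by metis
    then show ?case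
      by (auto simp: functor_category_def fun_eq_iff)
  qed
qed


section \<open>Independence of the alphabet type\<close>

lemma subword_inclusion_set: "subword_inclusion u v f \<Longrightarrow> set u \<subseteq> set v"
  unfolding subword_inclusion_def PiE_iff
  by (metis in_set_conv_nth lessThan_iff nth_mem subsetI)

lemma subword_inclusion_map:
  "subword_inclusion u v f \<Longrightarrow> subword_inclusion (map h u) (map h v) f"
  by (auto simp: subword_inclusion_def PiE_iff)

lemma hom_Sub:
  "x \<in> hom (Sub \<Sigma> w) u v \<longleftrightarrow> x \<in> hom (Word \<Sigma>) u v \<and>
    hom (Word \<Sigma>) u w \<noteq> {} \<and> hom (Word \<Sigma>) v w \<noteq> {}"
  by (auto simp: Sub_def full_subcategory_def hom_def Word_def)

lemma Obj_Sub:
  "u \<in> Obj (Sub \<Sigma> w) \<longleftrightarrow> u \<in> lists \<Sigma> \<and> w \<in> lists \<Sigma> \<and> (\<exists>f. subword_inclusion u w f)"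
  by (auto simp: Sub_def full_subcategory_def hom_def Word_def)

lemma weakly_word_embeddable_any_alphabet:
  fixes \<Sigma> :: "'s set"
  assumes "weak_word_embedding D \<Sigma> w F"
  shows "weakly_word_embeddable D"
proof -
  define S where "S = Sub \<Sigma> w"
  interpret F: is_functor D S F
    using assms by (simp add: weak_word_embedding_def S_def)
  obtain h :: "'s \<Rightarrow> nat" where h: "inj_on h (set w)"
    using finite_imp_inj_to_nat_seg[of "set w"] by auto
  define T where "T = Sub (UNIV :: nat set) (map h w)"
  interpret T: category T unfolding T_def by (rule category_Sub)
  define r where "r = (\<lambda>(u, v, f). (map h u, map h v, f) :: nat word_arrow)"
  have obj: "map h u \<in> Obj T" "set u \<subseteq> set w" if "u \<in> Obj S" for u
    using that subword_inclusion_map subword_inclusion_set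
    unfolding S_def T_def Obj_Sub by (auto simp: lists_UNIV) blast+
  have inj_map: "u = v" if "map h u = map h v" "u \<in> Obj S" "v \<in> Obj S" for u v
    using that obj(2) h by (metis inj_on_subset map_inj_on sup_least)
  have ro: "FObj F c \<in> Obj S" if "c \<in> Obj D" for c
    using F.FObj_funcset that by auto
  have rhom: "r x \<in> hom T (map h u) (map h v)" if "x \<in> hom S u v" for x u v
  proof -
    have map_hom: "(map h a, map h b, f) \<in> hom (Word UNIV) (map h a) (map h b)"
      if "(a, b, f) \<in> hom (Word \<Sigma>) a b" for a b f
      using that subword_inclusion_map by (auto simp: hom_Word)
    have "hom (Word UNIV) (map h a) (map h w) \<noteq> {}" if "hom (Word \<Sigma>) a w \<noteq> {}" for a
      using that map_hom by (metis all_not_in_conv hom_Word)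
    moreover have "x \<in> hom (Word \<Sigma>) u v" using that by (simp add: S_def hom_Sub)
    moreover from this obtain f where "x = (u, v, f)" by (auto simp: hom_Word)
    ultimately show ?thesis
      using that map_hom unfolding S_def T_def hom_Sub by (auto simp: r_def)
  qed
  define G where "G = \<lparr>FObj = (\<lambda>c\<in>Obj D. map h (FObj F c)),
    FArr = (\<lambda>f\<in>Arr D. r (FArr F f))\<rparr>"
  have D: "c \<in> Obj D" "d \<in> Obj D" "f \<in> Arr D" if "f \<in> hom D c d" for f c d
    using that F.src.Dom_in_Obj F.src.Cod_in_Obj by (auto simp: hom_def)
  have "is_functor D T G"
  proof (unfold_locales, goal_cases)
    case 1 then show ?case using ro obj(1) by (auto simp: G_def)
  next
    case 2
    have "r (FArr F f) \<in> Arr T" if "f \<in> Arr D" for f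
      using rhom[OF F.FArr_hom[OF homI[OF that refl refl]]] by (simp add: hom_def)
    then show ?case by (auto simp: G_def)
  next
    case (3 f c d) then show ?case
      using D[OF 3] rhom[OF F.FArr_hom[OF 3]] by (simp add: G_def)
  next
    case (4 c)
    then have "Ident D c \<in> Arr D" using F.src.Ident_in_hom by (auto simp: hom_def)
    with 4 show ?case
      by (simp add: G_def F.FArr_Ident)
         (simp add: r_def S_def T_def Sub_def full_subcategory_def Word_def)
  next
    case (5 f a b g c)
    have "Comp D g f \<in> Arr D" using F.src.Comp_in_hom[OF 5] by (simp add: hom_def)
    moreover have "r (Comp S y x) = Comp T (r y) (r x)" for x y
      by (simp add: r_def S_def T_def Sub_def full_subcategory_def Word_def split: prod.split)
    ultimately show ?case using F.FArr_Comp[OF 5] D[OF 5(1)] D[OF 5(2)] by (simp add: G_def)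
  qed
  moreover have "faithful D G"
    unfolding faithful_def
  proof (intro ballI inj_onI)
    fix c d x y
    assume cd: "c \<in> Obj D" "d \<in> Obj D" and xy: "x \<in> hom D c d" "y \<in> hom D c d"
      and eq: "FArr G x = FArr G y"
    have "r (FArr F x) = r (FArr F y)" using eq D[OF xy(1)] D[OF xy(2)] by (simp add: G_def)
    moreover have "\<exists>f. FArr F z = (FObj F c, FObj F d, f)" if "z \<in> hom D c d" for z
      using F.FArr_hom[OF that] by (auto simp: S_def hom_Sub hom_Word)
    then obtain f g where "FArr F x = (FObj F c, FObj F d, f)"
      "FArr F y = (FObj F c, FObj F d, g)" using xy by metis
    ultimately have "FArr F x = FArr F y" by (simp add: r_def)
    then show "x = y"
      using assms cd xy unfolding weak_word_embedding_def faithful_def by (auto dest: inj_onD)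
  qed
  moreover have "injective_on_objects D G"
    using assms inj_map ro unfolding weak_word_embedding_def injective_on_objects_def
    by (auto simp: inj_on_def G_def)
  moreover have "map h w \<in> Obj (Word UNIV)" by (simp add: Word_def)
  ultimately show ?thesis
    unfolding weakly_word_embeddable_def weak_word_embedding_def T_def by blast
qed

end

(*
  Monicity is inherited pointwise, acyclicity holds because a pair of opposite natural
  transformations forces all components to be identities, and sets of natural transformations
  are ordered lexicographically along an enumeration of the objects of I: at the first object
  where s and t differ, composition with u preserves the strict inequality.

  A finite acyclic left locally totally ordered category D embeds by a Yoneda construction. List
  the arrows into c block by block according to their domain, each block increasing, and read off
  the word of domains; composition with g : c -> e maps the list of c monotonically and
  injectively into that of e. The image of Ident c recovers g, so this is faithful, and if c and e
  have the same word then there are arrows c -> e and e -> c, so c = e.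
*)
theory Submission
  imports Defs
begin

section \<open>Lexicographic orders, increasing lists, and blocks of words\<close>

section \<open>Orders and words\<close>

text \<open>An element of \<open>T\<close> is identified with its family of values, and
  \<open>h\<close> well-orders the indices. Distinct families therefore have a first index of
  difference, and the linear order at that index compares them.\<close>

lemma linear_order_on_lexicographic:
  fixes h :: "'i \<Rightarrow> nat" and val :: "'t \<Rightarrow> 'i \<Rightarrow> 'b"
  assumes h: "inj_on h J"
    and r: "\<And>i. i \<in> J \<Longrightarrow> linear_order_on (B i) (r i)"
    and val: "\<And>t i. t \<in> T \<Longrightarrow> i \<in> J \<Longrightarrow> val t i \<in> B i"
    and val_inj: "\<And>s t. s \<in> T \<Longrightarrow> t \<in> T \<Longrightarrow> (\<And>i. i \<in> J \<Longrightarrow> val s i = val t i) \<Longrightarrow> s = t"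
  shows "linear_order_on T {(s, t). s \<in> T \<and> t \<in> T \<and>
    (s = t \<or> (\<exists>i\<in>J. (\<forall>j\<in>J. h j < h i \<longrightarrow> val s j = val t j) \<and>
       (val s i, val t i) \<in> r i \<and> val s i \<noteq> val t i))}"
proof -
  define less where "less s t \<longleftrightarrow> (\<exists>i\<in>J. (\<forall>j\<in>J. h j < h i \<longrightarrow> val s j = val t j) \<and>
       (val s i, val t i) \<in> r i \<and> val s i \<noteq> val t i)" for s t
  have tr: "trans (r i)" and an: "antisym (r i)" and to: "total_on (B i) (r i)" if "i \<in> J" for i
    using r[OF that] by (auto simp: order_on_defs)
  have less_trans: "less s u" if "less s t" "less t u" for s t u
  proof -
    obtain i where i: "i \<in> J" "\<forall>j\<in>J. h j < h i \<longrightarrow> val s j = val t j"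
       "(val s i, val t i) \<in> r i" "val s i \<noteq> val t i" using \<open>less s t\<close> by (auto simp: less_def)
    obtain k where k: "k \<in> J" "\<forall>j\<in>J. h j < h k \<longrightarrow> val t j = val u j"
       "(val t k, val u k) \<in> r k" "val t k \<noteq> val u k" using \<open>less t u\<close> by (auto simp: less_def)
    \<comment> \<open>The earlier of the two first differences decides between \<open>s\<close> and
      \<open>u\<close>; injectivity of \<open>h\<close> turns a tie into
      \<open>i = k\<close>.\<close>
    consider "h i < h k" | "h k < h i" | "i = k"
      using h i(1) k(1) by (meson inj_onD linorder_less_linear)
    then show ?thesis
    proof cases
      case 1
      then show ?thesis using i k unfolding less_def
        by (intro bexI[of _ i]) auto
    next
      case 2
      then show ?thesis using i k unfolding less_def
        by (intro bexI[of _ k]) auto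
    next
      case 3
      have "(val s i, val u i) \<in> r i" using tr[OF i(1)] i k 3 by (meson transD)
      \<comment> \<open>If the outer values agreed, the middle one would lie both above and below
        them, and antisymmetry would make all three equal.\<close>
      moreover have "val s i \<noteq> val u i" using an[OF i(1)] i k 3 by (metis antisymD)
      ultimately show ?thesis using i k 3 unfolding less_def
        by (intro bexI[of _ i]) auto
    qed
  qed
  have less_irrefl: "\<not> less s s" for s by (simp add: less_def)
  have less_total: "less s t \<or> less t s" if st: "s \<in> T" "t \<in> T" "s \<noteq> t" for s t
  proof -
    have "\<exists>i\<in>J. val s i \<noteq> val t i" using val_inj st by blast
    then obtain i where i: "i \<in> J" "val s i \<noteq> val t i"
      and least: "\<And>j. j \<in> J \<Longrightarrow> h j < h i \<Longrightarrow> val s j = val t j"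
      using ex_has_least_nat[of "\<lambda>i. i \<in> J \<and> val s i \<noteq> val t i" _ h]
      by (metis linorder_not_less)
    then have "(val s i, val t i) \<in> r i \<or> (val t i, val s i) \<in> r i"
      using to[OF i(1)] val st by (auto simp: total_on_def)
    then show ?thesis using i least unfolding less_def by metis
  qed
  show ?thesis
    unfolding less_def[symmetric] order_on_defs
    using less_trans less_irrefl less_total
    by (auto simp: refl_on_def trans_def antisym_def total_on_def)
qed

text \<open>Insertion sort for a relation controlled only on \<open>A\<close>: the new element goes
  after those below it and before the rest, which totality places above it.\<close>

lemma finite_ex_sorted_wrt_list:
  assumes "finite A" "transp_on A P" "totalp_on A P"
  shows "\<exists>xs. set xs = A \<and> sorted_wrt P xs"
  using assms
proof (induction A rule: finite_induct)
  case empty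
  then show ?case by simp
next
  case (insert x A)
  have "transp_on A P" "totalp_on A P"
    using insert.prems by (meson subset_insertI transp_on_subset totalp_on_subset)+
  then obtain xs where xs: "set xs = A" "sorted_wrt P xs" using insert.IH by blast
  let ?ys = "filter (\<lambda>y. P y x) xs @ x # filter (\<lambda>y. \<not> P y x) xs"
  have gt: "P x z" if "z \<in> A" "\<not> P z x" for z
    using that insert by (metis insertCI totalp_onD)
  have "P y z" if "y \<in> A" "z \<in> A" "P y x" "\<not> P z x" for y z
    using transp_onD[OF insert.prems(1), of y x z] gt that by simp
  then have "sorted_wrt P ?ys"
    using xs gt by (auto simp: sorted_wrt_append sorted_wrt_filter)
  moreover have "set ?ys = insert x A" using xs by auto
  ultimately show ?case by blast
qed

text \<open>Asymmetry rules out \<open>P\<close> both at equal and at reversed positions, so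
  comparing entries amounts to comparing positions; in particular no entry repeats.\<close>

lemma sorted_wrt_nth_less_iff:
  assumes "sorted_wrt P xs" "asymp_on (set xs) P" "i < length xs" "j < length xs"
  shows "P (xs ! i) (xs ! j) \<longleftrightarrow> i < j"
  using assms
  by (metis asymp_onD linorder_neqE_nat nth_mem sorted_wrt_nth_less)

lemma subword_inclusion_append:
  "subword_inclusion u (xs @ u @ ys) (\<lambda>i\<in>{..<length u}. length xs + i)"
  by (auto simp: subword_inclusion_def inj_on_def monotone_on_def nth_append)

text \<open>A block is embedded by shifting past everything before it. Concatenation thus puts
  finitely many words into one \<open>Sub\<close>.\<close>

lemma subword_inclusion_concat:
  assumes "u \<in> set us"
  shows "\<exists>f. subword_inclusion u (concat us) f"
proof -
  obtain xs ys where "us = xs @ u # ys" using split_list[OF assms] by blast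
  then show ?thesis using subword_inclusion_append[of u "concat xs" "concat ys"] by auto
qed

section \<open>The Yoneda embedding by words of domains\<close>

section \<open>Word embeddings\<close>

lemma (in category) hom_Obj: "f \<in> hom C c d \<Longrightarrow> c \<in> Obj C \<and> d \<in> Obj C"
  using Dom_in_Obj Cod_in_Obj by (auto simp: hom_def)

text \<open>The word of \<open>c\<close> flattens the representable functor of arrows into
  \<open>c\<close>. Finiteness makes it a list, left compatibility makes postcomposition increasing,
  and acyclicity separates objects.\<close>

lemma weakly_word_embeddable_if_left_locally_totally_ordered:
  fixes D :: "('o, 'm) precategory"
  assumes "finite_category D" "acyclic_category D" "left_locally_totally_ordered_category D"
  shows "weakly_word_embeddable D"
proof -
  interpret finite_category D by fact
  interpret acyclic_category D by fact
  obtain R where lin: "\<And>c d. c \<in> Obj D \<Longrightarrow> d \<in> Obj D \<Longrightarrow> linear_order_on (hom D c d) (R c d)"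
    and R_Comp: "\<And>c d e g f\<^sub>1 f\<^sub>2. c \<in> Obj D \<Longrightarrow> d \<in> Obj D \<Longrightarrow> e \<in> Obj D \<Longrightarrow>
      g \<in> hom D d e \<Longrightarrow> f\<^sub>1 \<in> hom D c d \<Longrightarrow> f\<^sub>2 \<in> hom D c d \<Longrightarrow> (f\<^sub>1, f\<^sub>2) \<in> R c d \<Longrightarrow> f\<^sub>1 \<noteq> f\<^sub>2 \<Longrightarrow>
      (Comp D g f\<^sub>1, Comp D g f\<^sub>2) \<in> R c e \<and> Comp D g f\<^sub>1 \<noteq> Comp D g f\<^sub>2"
    using left_locally_totally_ordered_category.ex_left_compatible_orders[OF assms(3)] by metis
  \<comment> \<open>An arbitrary numbering of the objects; it orders the blocks, and in the same way
    for every codomain.\<close>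
  obtain h :: "'o \<Rightarrow> nat" where h: "inj_on h (Obj D)"
    using finite_imp_inj_to_nat_seg[OF finite_Obj] by auto
  define into where "into c = {f \<in> Arr D. Cod D f = c}" for c
  define less where "less c x y \<longleftrightarrow> h (Dom D x) < h (Dom D y) \<or>
    Dom D x = Dom D y \<and> (x, y) \<in> R (Dom D x) c \<and> x \<noteq> y" for c x y
  have into_hom: "x \<in> into c \<longleftrightarrow> x \<in> hom D (Dom D x) c" for x c
    by (auto simp: into_def hom_def)
  have Dom_Obj: "Dom D x \<in> Obj D" if "x \<in> into c" for x c
    using that Dom_in_Obj by (auto simp: into_def)
  \<comment> \<open>Postcomposition keeps the domain, so it preserves both the letter of an arrow
    and the block in which it lies.\<close>
  have Dom_Comp: "Dom D (Comp D g x) = Dom D x" "Comp D g x \<in> into e"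
    if "g \<in> hom D c e" "x \<in> into c" for g c e x
    using Comp_in_hom[of x "Dom D x" c g e] that by (auto simp: into_def hom_def)
  have ord: "transp_on (into c) (less c)" "asymp_on (into c) (less c)"
    "totalp_on (into c) (less c)" if c: "c \<in> Obj D" for c
  proof -
    have tr: "trans (R d c)" and an: "antisym (R d c)" and to: "total_on (hom D d c) (R d c)"
      if "d \<in> Obj D" for d
      using lin[OF that c] by (auto simp: order_on_defs)
    show "transp_on (into c) (less c)"
    proof (rule transp_onI)
      fix x y z assume "x \<in> into c" and xy: "less c x y" and yz: "less c y z"
      then have "trans (R (Dom D x) c)" "antisym (R (Dom D x) c)" using tr an Dom_Obj by auto
      then show "less c x z" using xy yz unfolding less_def
        by (metis antisymD less_trans transD)
    qed
    show "asymp_on (into c) (less c)"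
    proof (rule asymp_onI)
      fix x y assume "x \<in> into c" and xy: "less c x y"
      then show "\<not> less c y x" using an[OF Dom_Obj] unfolding less_def
        by (metis antisymD less_asym)
    qed
    show "totalp_on (into c) (less c)"
    proof (rule totalp_onI)
      fix x y assume xy: "x \<in> into c" "y \<in> into c" "x \<noteq> y"
      consider "h (Dom D x) < h (Dom D y)" | "h (Dom D y) < h (Dom D x)" | "Dom D x = Dom D y"
        using h Dom_Obj xy by (meson inj_onD linorder_less_linear)
      then show "less c x y \<or> less c y x"
      proof cases
        case 3
        then have "(x, y) \<in> R (Dom D x) c \<or> (y, x) \<in> R (Dom D x) c"
          using to[OF Dom_Obj[OF xy(1)]] xy into_hom unfolding total_on_def by metis
        then show ?thesis using 3 xy by (auto simp: less_def)
      qed (auto simp: less_def)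
    qed
  qed
  \<comment> \<open>Between blocks the comparison depends only on the unchanged domains; within a
    block it is left compatibility of \<open>R\<close>.\<close>
  have less_Comp: "less e (Comp D g x) (Comp D g y)"
    if "g \<in> hom D c e" "x \<in> into c" "y \<in> into c" "less c x y" for g c e x y
    using that R_Comp[of "Dom D x" c e g x y] hom_Obj[OF that(1)] Dom_Obj[OF that(2)] into_hom[of x c]
      into_hom[of y c]
    by (auto simp: less_def Dom_Comp[OF that(1,2)] Dom_Comp[OF that(1,3)])
  have "finite (into c)" for c using finite_Arr by (simp add: into_def)
  then have "\<forall>c\<in>Obj D. \<exists>xs. set xs = into c \<and> sorted_wrt (less c) xs"
    using finite_ex_sorted_wrt_list ord by blast
  then obtain L where L: "\<And>c. c \<in> Obj D \<Longrightarrow> set (L c) = into c"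
    and sorted: "\<And>c. c \<in> Obj D \<Longrightarrow> sorted_wrt (less c) (L c)" by metis
  have nth_into: "L c ! i \<in> into c" if "c \<in> Obj D" "i < length (L c)" for c i
    using that L nth_mem by blast
  have nth_less: "less c (L c ! i) (L c ! j) \<longleftrightarrow> i < j"
    if "c \<in> Obj D" "i < length (L c)" "j < length (L c)" for c i j
    using sorted_wrt_nth_less_iff[OF sorted] ord(2) L that by simp
  \<comment> \<open>The condition stands inside the existential so that \<open>pos\<close> becomes a
    total function; its value is arbitrary unless \<open>x\<close> is an arrow into
    \<open>c\<close>.\<close>
  have "\<forall>c x. \<exists>p. c \<in> Obj D \<and> x \<in> into c \<longrightarrow> p < length (L c) \<and> L c ! p = x"
    using L by (metis in_set_conv_nth)
  then obtain pos where pos: "\<And>c x. c \<in> Obj D \<Longrightarrow> x \<in> into c \<Longrightarrow> pos c x < length (L c)"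
    and nth_pos: "\<And>c x. c \<in> Obj D \<Longrightarrow> x \<in> into c \<Longrightarrow> L c ! pos c x = x" by metis
  \<comment> \<open>Were the two positions different, the arrow at them would be strictly less than
    itself.\<close>
  have pos_nth: "pos c (L c ! i) = i" if "c \<in> Obj D" "i < length (L c)" for c i
  proof -
    have x: "L c ! i \<in> into c" using nth_into that by blast
    show ?thesis
      using nth_less[OF that(1) pos[OF that(1) x] that(2)]
        nth_less[OF that(1) that(2) pos[OF that(1) x]] nth_less[OF that(1) that(2) that(2)] nth_pos[OF that(1) x] by simp
  qed
  have pos_less: "pos c x < pos c y \<longleftrightarrow> less c x y"
    if "c \<in> Obj D" "x \<in> into c" "y \<in> into c" for c x y
    using nth_less[OF that(1) pos[OF that(1,2)] pos[OF that(1,3)]] nth_pos that by simp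
  define W where "W c = map (Dom D) (L c)" for c
  \<comment> \<open>Postcomposition with \<open>g\<close>, transported from arrows to their
    positions and made extensional.\<close>
  define act where "act g = (\<lambda>i\<in>{..<length (L (Dom D g))}.
    pos (Cod D g) (Comp D g (L (Dom D g) ! i)))" for g
  have act: "act g = (\<lambda>i\<in>{..<length (L c)}. pos e (Comp D g (L c ! i)))"
    if "g \<in> hom D c e" for g c e using that by (simp add: act_def hom_def)
  have act_less: "act g i < act g j" if "g \<in> hom D c e" "i < j" "j < length (L c)" for g c e i j
    using that hom_Obj[OF that(1)] nth_into nth_less Dom_Comp(2)[OF that(1)]
      less_Comp[OF that(1)] pos_less
    by (simp add: act[OF that(1)])
  have act_incl: "subword_inclusion (W c) (W e) (act g)" if g: "g \<in> hom D c e" for g c e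
  proof -
    have ce: "c \<in> Obj D" "e \<in> Obj D" using hom_Obj[OF g] by auto
    have in_e: "Comp D g (L c ! i) \<in> into e" if "i < length (L c)" for i
      using Dom_Comp[OF g] nth_into ce that by blast
    have "act g \<in> {..<length (L c)} \<rightarrow>\<^sub>E {..<length (L e)}"
      using in_e pos ce by (auto simp: act[OF g])
    \<comment> \<open>Strictness yields at once the injectivity and the monotonicity of a subword
      inclusion.\<close>
    moreover have "strict_mono_on {..<length (L c)} (act g)"
      using act_less[OF g] by (intro strict_mono_onI) auto
    moreover have "W e ! act g i = W c ! i" if "i < length (L c)" for i
      using that ce in_e pos nth_pos Dom_Comp(1)[OF g] nth_into by (simp add: W_def act[OF g])
    ultimately show ?thesis
      unfolding subword_inclusion_def
      by (auto simp: W_def strict_mono_on_imp_inj_on strict_mono_on_imp_mono_on)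
  qed
  obtain os where os: "set os = Obj D" using finite_list[OF finite_Obj] by blast
  \<comment> \<open>An object may occur repeatedly in \<open>os\<close>; what matters is that each
    \<open>W c\<close> is a block of \<open>w\<close>.\<close>
  define w where "w = concat (map W os)"
  have W_incl: "\<exists>f. subword_inclusion (W c) w f" if "c \<in> Obj D" for c
    unfolding w_def using that os by (intro subword_inclusion_concat) auto
  \<comment> \<open>The objects of \<open>D\<close> serve as letters here;
    \<open>weakly_word_embeddable_any_alphabet\<close> finally replaces them by natural
    numbers.\<close>
  let ?S = "Sub (UNIV :: 'o set) w"
  interpret S: category ?S by (rule category_Sub)
  have W_hom: "(W c, W e, act g) \<in> hom ?S (W c) (W e)" if "g \<in> hom D c e" for c e g
    using act_incl[OF that] W_incl hom_Obj[OF that]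
    unfolding hom_Sub hom_Word by (auto simp: ex_in_conv[symmetric] hom_Word)
  define F :: "('o, 'm, 'o list, 'o word_arrow) functor_data" where
    "F = \<lparr>FObj = (\<lambda>c\<in>Obj D. W c), FArr = (\<lambda>g\<in>Arr D. (W (Dom D g), W (Cod D g), act g))\<rparr>"
  have FArr: "FArr F g = (W c, W e, act g)" if "g \<in> hom D c e" for g c e
    using that by (simp add: F_def hom_def)
  have "is_functor D ?S F"
  proof (unfold_locales, goal_cases)
    case 1
    then show ?case using W_incl by (auto simp: F_def Obj_Sub)
  next
    case 2
    have "FArr F g \<in> Arr ?S" if "g \<in> Arr D" for g
      using W_hom[OF homI[OF that refl refl]] that by (simp add: F_def hom_def)
    then show ?case by (auto simp: F_def)
  next
    case (3 g c e)
    then show ?case using W_hom FArr hom_Obj[OF 3] by (simp add: F_def)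
  next
    case (4 c)
    have "Comp D (Ident D c) (L c ! i) = L c ! i" if "i < length (L c)" for i
      using nth_into[OF 4 that] Comp_Ident_left into_hom by blast
    then have "act (Ident D c) = (\<lambda>i\<in>{..<length (W c)}. i)"
      using pos_nth 4 by (auto simp: act[OF Ident_in_hom[OF 4]] W_def)
    then show ?case using FArr[OF Ident_in_hom[OF 4]] 4
      by (simp add: F_def Sub_def full_subcategory_def Word_def)
  next
    case (5 f a b g c)
    note gf = Comp_in_hom[OF 5]
    have abc: "a \<in> Obj D" "b \<in> Obj D" "c \<in> Obj D" using hom_Obj 5 by auto
    have "act (Comp D g f) i = act g (act f i)" if i: "i < length (L a)" for i
    proof -
      have x: "L a ! i \<in> into a" using nth_into abc i by blast
      then have "Comp D g (Comp D f (L a ! i)) = Comp D (Comp D g f) (L a ! i)"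
        using Comp_assoc 5 into_hom by blast
      \<comment> \<open>\<open>nth_pos\<close> cancels the passage to a position and back, which
        leaves associativity.\<close>
      then show ?thesis
        using i abc Dom_Comp(2)[OF 5(1) x] pos nth_pos
        by (simp add: act[OF gf] act[OF 5(1)] act[OF 5(2)])
    qed
    then have "act (Comp D g f) = (\<lambda>i\<in>{..<length (W a)}. act g (act f i))"
      using act[OF gf] by (auto simp: W_def)
    then show ?case using FArr[OF 5(1)] FArr[OF 5(2)] FArr[OF gf]
      by (simp add: Sub_def full_subcategory_def Word_def)
  qed
  moreover have "faithful D F"
    unfolding faithful_def
  proof (intro ballI inj_onI)
    fix c e f g
    assume ce: "c \<in> Obj D" "e \<in> Obj D" and fg: "f \<in> hom D c e" "g \<in> hom D c e"
      and eq: "FArr F f = FArr F g"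
    \<comment> \<open>The identity occurs in the list of \<open>c\<close>; evaluating
      \<open>act k\<close> at its position reads off \<open>k\<close>.\<close>
    have id: "Ident D c \<in> into c" using Ident_in_hom[OF ce(1)] by (auto simp: into_def hom_def)
    have into_e: "k \<in> into e" and
      act_id: "act k (pos c (Ident D c)) = pos e k" if "k \<in> hom D c e" for k
      using that ce pos[OF ce(1) id] nth_pos[OF ce(1) id] Comp_Ident_right[OF that]
      by (auto simp: act[OF that] into_def hom_def)
    have "act f = act g" using eq FArr[OF fg(1)] FArr[OF fg(2)] by simp
    then have "pos e f = pos e g" using act_id fg by metis
    then show "f = g" using nth_pos[OF ce(2)] into_e fg by metis
  qed
  moreover have "injective_on_objects D F"
    unfolding injective_on_objects_def
  proof (rule inj_onI)
    fix c e assume ce: "c \<in> Obj D" "e \<in> Obj D" and eq: "FObj F c = FObj F e"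
    have ne: "d \<in> set (W c) \<longleftrightarrow> hom D d c \<noteq> {}" if "c \<in> Obj D" for c d
      using L[OF that] by (auto simp: W_def into_def hom_def)
    \<comment> \<open>Through its identity each object is a letter of its own word, hence of the
      equal word of the other object.\<close>
    have "hom D c c \<noteq> {}" "hom D e e \<noteq> {}" using Ident_in_hom ce by auto
    moreover have "W c = W e" using eq ce by (simp add: F_def)
    ultimately have "hom D c e \<noteq> {}" "hom D e c \<noteq> {}" using ne ce by metis+
    then show "c = e" using hom_antisym ce by blast
  qed
  ultimately have "weak_word_embedding D UNIV w F"
    unfolding weak_word_embedding_def by (simp add: Word_def)
  then show ?thesis by (rule weakly_word_embeddable_any_alphabet)
qed

section \<open>Pointwise inheritance and lexicographic orders on natural transformations\<close>

section \<open>Properties inherited by functor categories\<close>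

lemma nat_trans_homD:
  assumes "t \<in> hom (functor_category I C) F G"
  shows "is_functor I C F" "is_functor I C G" "NComp t \<in> extensional (Obj I)"
    and "i \<in> Obj I \<Longrightarrow> NComp t i \<in> hom C (FObj F i) (FObj G i)"
    and "f \<in> hom I i j \<Longrightarrow> Comp C (NComp t j) (FArr F f) = Comp C (FArr G f) (NComp t i)"
  using assms unfolding hom_functor_category
  by (auto simp: is_nat_trans_def is_nat_trans_axioms_def)

text \<open>Source and target are fixed by the hom-set, and extensionality fixes the components off
  \<open>Obj I\<close>.\<close>

lemma nat_trans_hom_eqI:
  assumes "s \<in> hom (functor_category I C) F G" "t \<in> hom (functor_category I C) F G"
    and "\<And>i. i \<in> Obj I \<Longrightarrow> NComp s i = NComp t i"
  shows "s = t"
  using assms by (intro nat_trans_data_eqI[where A = "Obj I"])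
    (auto simp: hom_functor_category dest: is_nat_trans.NComp_extensional)

lemma FObj_in_Obj: "is_functor C D F \<Longrightarrow> c \<in> Obj C \<Longrightarrow> FObj F c \<in> Obj D"
  using is_functor.FObj_funcset by blast

text \<open>Functors and component families are extensional maps between finite sets, of which there
  are finitely many.\<close>

lemma finite_category_functor_category:
  fixes I :: "('i, 'a) precategory" and C :: "('o, 'm) precategory"
  assumes "finite_category I" "finite_category C"
  shows "finite_category (functor_category I C)"
proof -
  interpret I: finite_category I by fact
  interpret C: finite_category C by fact
  let ?D = "functor_category I C"
  interpret D: category ?D
    by (rule category_functor_category) unfold_locales
  have obj: "finite (Obj ?D)"
  proof (rule finite_subset)
    show "Obj ?D \<subseteq> (\<lambda>(a, b). \<lparr>FObj = a, FArr = b\<rparr>) `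
        ((Obj I \<rightarrow>\<^sub>E Obj C) \<times> (Arr I \<rightarrow>\<^sub>E Arr C))"
    proof
      fix F assume "F \<in> Obj ?D"
      then interpret is_functor I C F by (simp add: functor_category_def)
      show "F \<in> (\<lambda>(a, b). \<lparr>FObj = a, FArr = b\<rparr>) ` ((Obj I \<rightarrow>\<^sub>E Obj C) \<times> (Arr I \<rightarrow>\<^sub>E Arr C))"
        using FObj_funcset FArr_funcset by (intro image_eqI[of _ _ "(FObj F, FArr F)"]) auto
    qed
    show "finite ((\<lambda>(a, b). \<lparr>FObj = a, FArr = b\<rparr>) `
        ((Obj I \<rightarrow>\<^sub>E Obj C) \<times> (Arr I \<rightarrow>\<^sub>E Arr C)))"
      using I.finite_Obj I.finite_Arr C.finite_Obj C.finite_Arr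
      by (intro finite_imageI finite_cartesian_product finite_PiE) auto
  qed
  have arr: "finite (Arr ?D)"
  proof (rule finite_subset)
    \<comment> \<open>An arrow carries its source and target, so this count rests on that of the
      objects.\<close>
    show "Arr ?D \<subseteq> (\<lambda>(a, b, c). \<lparr>NSrc = a, NTgt = b, NComp = c\<rparr>) `
        (Obj ?D \<times> Obj ?D \<times> (Obj I \<rightarrow>\<^sub>E Arr C))"
    proof
      fix t assume t: "t \<in> Arr ?D"
      then interpret is_nat_trans I C t by (simp add: functor_category_def)
      have "NComp t \<in> Obj I \<rightarrow>\<^sub>E Arr C"
        using NComp_extensional NComp_hom by (auto simp: PiE_iff hom_def)
      moreover have "NSrc t \<in> Obj ?D" "NTgt t \<in> Obj ?D"
        using src.is_functor_axioms tgt.is_functor_axioms by (auto simp: functor_category_def)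
      ultimately show "t \<in> (\<lambda>(a, b, c). \<lparr>NSrc = a, NTgt = b, NComp = c\<rparr>) `
        (Obj ?D \<times> Obj ?D \<times> (Obj I \<rightarrow>\<^sub>E Arr C))"
        by (intro image_eqI[of _ _ "(NSrc t, NTgt t, NComp t)"]) auto
    qed
    show "finite ((\<lambda>(a, b, c). \<lparr>NSrc = a, NTgt = b, NComp = c\<rparr>) `
        (Obj ?D \<times> Obj ?D \<times> (Obj I \<rightarrow>\<^sub>E Arr C)))"
      using obj I.finite_Obj C.finite_Arr
      by (intro finite_imageI finite_cartesian_product finite_PiE) auto
  qed
  show ?thesis by unfold_locales (fact obj arr)+
qed

text \<open>Opposite components force \<open>F\<close> and \<open>G\<close> to agree on objects; the
  components are then identities, and naturality collapses to agreement on arrows.\<close>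

lemma acyclic_category_functor_category:
  fixes I :: "('i, 'a) precategory" and C :: "('o, 'm) precategory"
  assumes "category I" "acyclic_category C"
  shows "acyclic_category (functor_category I C)"
proof -
  interpret I: category I by fact
  interpret C: acyclic_category C by fact
  let ?D = "functor_category I C"
  interpret D: category ?D
    by (rule category_functor_category) unfold_locales
  show ?thesis
  proof (unfold_locales, goal_cases)
    case (1 F G)
    show ?case
    proof (rule ccontr)
      assume "hom ?D G F \<noteq> {}"
      then obtain s t where t: "t \<in> hom ?D F G" and s: "s \<in> hom ?D G F" using 1 by blast
      interpret F: is_functor I C F using nat_trans_homD(1)[OF t] .
      interpret G: is_functor I C G using nat_trans_homD(2)[OF t] .
      have obj: "FObj F i = FObj G i" if i: "i \<in> Obj I" for i
        using nat_trans_homD(4)[OF t i] nat_trans_homD(4)[OF s i] C.hom_antisym C.hom_Obj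
        by (metis empty_iff)
      have ident: "NComp t i = Ident C (FObj F i)" if i: "i \<in> Obj I" for i
        using nat_trans_homD(4)[OF t i] C.hom_self C.hom_Obj obj[OF i] by fastforce
      have arr: "FArr F f = FArr G f" if f_arr: "f \<in> Arr I" for f
      proof -
        obtain i j where f: "f \<in> hom I i j" using f_arr by (auto simp: hom_def)
        have ij: "i \<in> Obj I" "j \<in> Obj I" using I.hom_Obj[OF f] by auto
        have "FArr F f = Comp C (NComp t j) (FArr F f)"
          using C.Comp_Ident_left[OF F.FArr_hom[OF f]] ident ij by simp
        also have "\<dots> = Comp C (FArr G f) (NComp t i)" by (rule nat_trans_homD(5)[OF t f])
        also have "\<dots> = FArr G f"
          using C.Comp_Ident_right[OF G.FArr_hom[OF f]] ident obj ij by simp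
        finally show ?thesis .
      qed
      have "FObj F = FObj G" using F.FObj_funcset G.FObj_funcset obj by (rule PiE_ext)
      moreover have "FArr F = FArr G" using F.FArr_funcset G.FArr_funcset arr by (rule PiE_ext)
      ultimately show False using \<open>F \<noteq> G\<close> by simp
    qed
  next
    case (2 F)
    have F: "is_functor I C F" using 2 by (simp add: functor_category_def)
    have id: "Ident ?D F \<in> hom ?D F F" by (rule D.Ident_in_hom[OF 2])
    have "t = Ident ?D F" if t: "t \<in> hom ?D F F" for t
      using nat_trans_homD(4)[OF t] nat_trans_homD(4)[OF id] C.hom_self FObj_in_Obj[OF F]
      by (intro nat_trans_hom_eqI[OF t id]) fastforce
    then show ?case using id by blast
  qed
qed

lemma NComp_Comp:
  "i \<in> Obj I \<Longrightarrow> NComp (Comp (functor_category I C) s t) i = Comp C (NComp s i) (NComp t i)"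
  by (simp add: functor_category_def)

text \<open>Composition is computed at each object, where the component of \<open>u\<close> can be
  cancelled.\<close>

lemma monic_category_functor_category:
  fixes I :: "('i, 'a) precategory" and C :: "('o, 'm) precategory"
  assumes "category I" "monic_category C"
  shows "monic_category (functor_category I C)"
proof -
  interpret I: category I by fact
  interpret C: monic_category C by fact
  let ?D = "functor_category I C"
  interpret D: category ?D
    by (rule category_functor_category) unfold_locales
  have mono: "f = g" if "k \<in> hom C b c" "f \<in> hom C a b" "g \<in> hom C a b"
    "Comp C k f = Comp C k g" for k a b c f g
    using C.all_mono[of k] that C.hom_Obj[OF that(2)] by (auto simp: monomorphism_def hom_def)
  have "monomorphism ?D u" if u: "u \<in> Arr ?D" for u
    unfolding monomorphism_def
  proof (intro conjI ballI impI)
    fix F s t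
    assume s: "s \<in> hom ?D F (Dom ?D u)" and t: "t \<in> hom ?D F (Dom ?D u)"
      and eq: "Comp ?D u s = Comp ?D u t"
    have u: "u \<in> hom ?D (Dom ?D u) (Cod ?D u)" using u by (simp add: hom_def)
    show "s = t"
    proof (rule nat_trans_hom_eqI[OF s t])
      fix i assume i: "i \<in> Obj I"
      have "Comp C (NComp u i) (NComp s i) = Comp C (NComp u i) (NComp t i)"
        using eq NComp_Comp[OF i] by metis
      then show "NComp s i = NComp t i"
        by (rule mono[OF nat_trans_homD(4)[OF u i] nat_trans_homD(4)[OF s i]
              nat_trans_homD(4)[OF t i]])
    qed
  qed (fact u)
  then show ?thesis by unfold_locales
qed

lemma left_locally_totally_ordered_category_functor_category:
  fixes I :: "('i, 'a) precategory" and C :: "('o, 'm) precategory"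
  assumes "finite_category I" "left_locally_totally_ordered_category C"
  shows "left_locally_totally_ordered_category (functor_category I C)"
proof -
  interpret I: finite_category I by fact
  interpret C: left_locally_totally_ordered_category C by fact
  let ?D = "functor_category I C"
  interpret D: category ?D
    by (rule category_functor_category) unfold_locales
  obtain R where lin: "\<And>c d. c \<in> Obj C \<Longrightarrow> d \<in> Obj C \<Longrightarrow> linear_order_on (hom C c d) (R c d)"
    and R_Comp: "\<And>c d e g f\<^sub>1 f\<^sub>2. c \<in> Obj C \<Longrightarrow> d \<in> Obj C \<Longrightarrow> e \<in> Obj C \<Longrightarrow>
      g \<in> hom C d e \<Longrightarrow> f\<^sub>1 \<in> hom C c d \<Longrightarrow> f\<^sub>2 \<in> hom C c d \<Longrightarrow> (f\<^sub>1, f\<^sub>2) \<in> R c d \<Longrightarrow> f\<^sub>1 \<noteq> f\<^sub>2 \<Longrightarrow>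
      (Comp C g f\<^sub>1, Comp C g f\<^sub>2) \<in> R c e \<and> Comp C g f\<^sub>1 \<noteq> Comp C g f\<^sub>2"
    using C.ex_left_compatible_orders by metis
  \<comment> \<open>One numbering serves all pairs \<open>F\<close>, \<open>G\<close>, so first
    differences are comparable across hom-sets.\<close>
  obtain h :: "'i \<Rightarrow> nat" where h: "inj_on h (Obj I)"
    using finite_imp_inj_to_nat_seg[OF I.finite_Obj] by auto
  define Q where "Q F G = {(s, t). s \<in> hom ?D F G \<and> t \<in> hom ?D F G \<and>
    (s = t \<or> (\<exists>i\<in>Obj I. (\<forall>j\<in>Obj I. h j < h i \<longrightarrow> NComp s j = NComp t j) \<and>
       (NComp s i, NComp t i) \<in> R (FObj F i) (FObj G i) \<and> NComp s i \<noteq> NComp t i))}" for F G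
  have Q_linear: "linear_order_on (hom ?D F G) (Q F G)" if "F \<in> Obj ?D" "G \<in> Obj ?D" for F G
  proof -
    have "is_functor I C F" "is_functor I C G" using that by (auto simp: functor_category_def)
    then show ?thesis
      unfolding Q_def
      by (intro linear_order_on_lexicographic[where B = "\<lambda>i. hom C (FObj F i) (FObj G i)"]
          h lin FObj_in_Obj)
        (auto intro: nat_trans_homD(4) nat_trans_hom_eqI)
  qed
  have Q_Comp: "(Comp ?D u s, Comp ?D u t) \<in> Q F H \<and> Comp ?D u s \<noteq> Comp ?D u t"
    if u: "u \<in> hom ?D G H" and s: "s \<in> hom ?D F G" and t: "t \<in> hom ?D F G"
      and st: "(s, t) \<in> Q F G" "s \<noteq> t" for F G H u s t
  proof -
    obtain i where i: "i \<in> Obj I" "\<forall>j\<in>Obj I. h j < h i \<longrightarrow> NComp s j = NComp t j"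
      "(NComp s i, NComp t i) \<in> R (FObj F i) (FObj G i)" "NComp s i \<noteq> NComp t i"
      using st by (auto simp: Q_def)
    note hs = nat_trans_homD(4)[OF s i(1)] and ht = nat_trans_homD(4)[OF t i(1)]
      and hu = nat_trans_homD(4)[OF u i(1)]
    let ?us = "Comp ?D u s" and ?ut = "Comp ?D u t"
    \<comment> \<open>The first difference of \<open>s\<close> and \<open>t\<close> stays the first
      difference after composition: strictness survives at \<open>i\<close>, and equality survives
      before it.\<close>
    have less: "(NComp ?us i, NComp ?ut i) \<in> R (FObj F i) (FObj H i) \<and> NComp ?us i \<noteq> NComp ?ut i"
      using R_Comp[OF _ _ _ hu hs ht i(3,4)] C.hom_Obj[OF hs] C.hom_Obj[OF hu] i(1)
      by (simp add: NComp_Comp)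
    moreover have "\<forall>j\<in>Obj I. h j < h i \<longrightarrow> NComp ?us j = NComp ?ut j"
      using i(2) by (simp add: NComp_Comp)
    ultimately show ?thesis
      using D.Comp_in_hom[OF s u] D.Comp_in_hom[OF t u] i(1) unfolding Q_def by auto
  qed
  show ?thesis
    using Q_linear Q_Comp by unfold_locales (intro exI[of _ Q], blast)
qed

theorem proposition5p19:
  fixes I :: "('i, 'a) precategory" and C :: "('o, 'm) precategory"
  assumes "finite_category I" and "acyclic_category I"
    and "finite_category C" and "acyclic_category C"
    and "monic_category C" and "left_locally_totally_ordered_category C"
  shows "finite_category (functor_category I C) \<and>
    acyclic_category (functor_category I C) \<and>
    monic_category (functor_category I C) \<and>
    left_locally_totally_ordered_category (functor_category I C) \<and>
    weakly_word_embeddable (functor_category I C)"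
proof -
  have "category I" using assms(1) by (rule finite_category.axioms)
  \<comment> \<open>The word embedding is applied to the functor category itself, by means of the
    finiteness, acyclicity and orders it has inherited.\<close>
  with assms show ?thesis
    by (simp add: finite_category_functor_category acyclic_category_functor_category
        monic_category_functor_category left_locally_totally_ordered_category_functor_category
        weakly_word_embeddable_if_left_locally_totally_ordered)
qed

end
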